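(* Let $\phi:\mathbb{R}^n\to\overline{\mathbb{R}}$ be a proper lower semicontinuous function bounded from below, let $a,b>0$, and let $\{x^k\}_{k\ge 0}\subset\mathbb{R}^n$ be a sequence such that for each $k\in\mathbb{N}$ one has $\phi(x^{k+1})+a\|x^{k+1}-x^k\|^2\le\phi(x^k)$, and there exists $w^{k}\in\partial\phi(x^{k})$ with $\|w^{k}\|\le b\|x^{k+1}-x^k\|$. Let $\bar x\in\mathrm{dom}\,\phi$ be an accumulation point of $\{x^k\}$ such that, for some subsequence, $x^{k_j}\to\bar x$ and $\phi(x^{k_j})\to\phi(\bar x)$ as $j\to\infty$. Suppose that $\phi$ satisfies the exponent PLK condition at $\bar x$ with $\varphi(t)=Mt^{1-q}$ for some $M>0$ and $q\in[0,1)$. Then: (i) If $q\in[0,\frac12)$, then $\{x^k\}$ and $\{\phi(x^k)\}$ terminate in a finite number of steps at $\bar x$ and $\phi(\bar x)$, respectively. (ii) If $q=\frac12$, then $\{x^k\}$ and $\{\phi(x^k)\}$ converge linearly to $\bar x$ and $\phi(\bar x)$, respectively. (iii) If $q\in(\frac12,1)$, then there exists a constant $\sigma>0$ such that $\|x^k-\bar x\|\le\sigma\,k^{-\frac{1-q}{2q-1}}$ for all large $k\in\mathbb{N}$.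
   Context: $\overline{\mathbb{R}}:=\mathbb{R}\cup\{\infty\}$, $\mathrm{dom}\,\phi:=\{x\mid\phi(x)<\infty\}$, $\mathbb{N}:=\{1,2,\ldots\}$, $\mathrm{dist}(0,\emptyset):=\infty$. For $x\in\mathrm{dom}\,\phi$, the regular subdifferential $\widehat\partial\phi(x)$ is the set of $v\in\mathbb{R}^n$ with $\liminf_{u\to x,\,u\ne x}\frac{\phi(u)-\phi(x)-\langle v,u-x\rangle}{\|u-x\|}\ge 0$, and the limiting (Mordukhovich) subdifferential is $$\partial\phi(x):=\{v\in\mathbb{R}^n\mid \exists\, x_k\to x,\ \phi(x_k)\to\phi(x),\ v_k\in\widehat\partial\phi(x_k),\ v_k\to v\};$$ both sets are empty if $x\notin\mathrm{dom}\,\phi$. Exponent PLK condition at $\bar x\in\mathrm{dom}\,\phi$ with $\varphi(t)=Mt^{1-q}$ ($M>0$, $q\in[0,1)$): there exist $\eta\in(0,\infty)$ and a neighborhood $U$ of $\bar x$ such that $$M(1-q)\big(\phi(x)-\phi(\bar x)\big)^{-q}\,\mathrm{dist}\big(0,\partial\phi(x)\big)\ge 1\quad\text{for all }x\in U\text{ with }\phi(\bar x)<\phi(x)<\phi(\bar x)+\eta.$$ Terminology: a sequence terminates at a point in a finite number of steps if it equals that point for all large $k$. $\{x^k\}$ converges linearly to $\bar x$ if there are $C>0$ and $c\in(0,1)$ with $\|x^k-\bar x\|\le C c^k$ for all large $k$. $\{\phi(x^k)\}$ converges linearly to $\phi(\bar x)$ if there is $c\in(0,1)$ with $|\phi(x^{k+1})-\phi(\bar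 x)|\le c\,|\phi(x^k)-\phi(\bar x)|$ for all large $k$. *)

theory Defs
  imports "HOL-Analysis.Analysis"
begin

text \<open>
  Functions into \<open>\<real> \<union> {\<infinity>}\<close> are modelled as \<^typ>\<open>ereal\<close>-valued functions; the value
  \<open>-\<infinity>\<close> is excluded by properness.
\<close>

definition edom :: "('a \<Rightarrow> ereal) \<Rightarrow> 'a set" where
  "edom \<phi> = {x. \<phi> x < \<infinity>}"

definition proper_fun :: "('a \<Rightarrow> ereal) \<Rightarrow> bool" where
  "proper_fun \<phi> \<longleftrightarrow> (\<forall>x. \<phi> x \<noteq> -\<infinity>) \<and> edom \<phi> \<noteq> {}"

definition bounded_from_below :: "('a \<Rightarrow> ereal) \<Rightarrow> bool" where
  "bounded_from_below \<phi> \<longleftrightarrow> (\<exists>m::real. \<forall>x. ereal m \<le> \<phi> x)"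

definition lower_semicontinuous :: "('a::topological_space \<Rightarrow> ereal) \<Rightarrow> bool" where
  "lower_semicontinuous \<phi> \<longleftrightarrow> (\<forall>x. \<phi> x \<le> Liminf (at x) \<phi>)"

definition regular_subdifferential ::
    "('a::euclidean_space \<Rightarrow> ereal) \<Rightarrow> 'a \<Rightarrow> 'a set" where
  "regular_subdifferential \<phi> x =
     {v. x \<in> edom \<phi> \<and>
         Liminf (at x) (\<lambda>u. (\<phi> u - \<phi> x - ereal (v \<bullet> (u - x))) / ereal (norm (u - x))) \<ge> 0}"

definition limiting_subdifferential ::
    "('a::euclidean_space \<Rightarrow> ereal) \<Rightarrow> 'a \<Rightarrow> 'a set" where
  "limiting_subdifferential \<phi> x =
     {v. x \<in> edom \<phi> \<and>
         (\<exists>y w. y \<longlonglongrightarrow> x \<and> (\<lambda>k. \<phi> (y k)) \<longlonglongrightarrow> \<phi> x \<and>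
                (\<forall>k. w k \<in> regular_subdifferential \<phi> (y k)) \<and> w \<longlonglongrightarrow> v)}"

text \<open>
  Unlike \<^const>\<open>infdist\<close>, which is \<open>0\<close> on the empty set, the following distance to the
  empty set is \<open>\<infinity>\<close>.
\<close>

definition edist_to_set :: "'a::metric_space \<Rightarrow> 'a set \<Rightarrow> ereal" where
  "edist_to_set x S = (INF v\<in>S. ereal (dist x v))"

text \<open>
  The condition \<open>\<psi>' (\<phi> x - \<phi> xbar) * dist (0, \<partial>\<phi> x) \<ge> 1\<close> for the desingularizing function
  \<open>\<psi> t = M * t powr (1 - q)\<close>. On the range of \<open>x\<close> considered, \<open>\<phi> x - \<phi> xbar\<close> is a positive
  real number, so \<^const>\<open>real_of_ereal\<close> loses nothing there.
\<close>

definition exponent_PLK ::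
    "('a::euclidean_space \<Rightarrow> ereal) \<Rightarrow> 'a \<Rightarrow> real \<Rightarrow> real \<Rightarrow> bool" where
  "exponent_PLK \<phi> xbar M q \<longleftrightarrow>
     (\<exists>\<eta>::real. \<eta> > 0 \<and> (\<exists>U. open U \<and> xbar \<in> U \<and>
        (\<forall>x\<in>U. \<phi> xbar < \<phi> x \<and> \<phi> x < \<phi> xbar + ereal \<eta> \<longrightarrow>
           ereal (M * (1 - q) * real_of_ereal (\<phi> x - \<phi> xbar) powr (- q))
             * edist_to_set 0 (limiting_subdifferential \<phi> x) \<ge> 1)))"

definition terminates_at :: "(nat \<Rightarrow> 'a) \<Rightarrow> 'a \<Rightarrow> bool" where
  "terminates_at s l \<longleftrightarrow> (\<forall>\<^sub>F k in sequentially. s k = l)"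

text \<open>
  Linear convergence of points (\<open>R\<close>-linear) and of function values (\<open>Q\<close>-linear) are
  different notions.
\<close>

definition linearly_convergent_points :: "(nat \<Rightarrow> 'a::real_normed_vector) \<Rightarrow> 'a \<Rightarrow> bool" where
  "linearly_convergent_points x l \<longleftrightarrow>
     (\<exists>C c. C > 0 \<and> 0 < c \<and> c < 1 \<and> (\<forall>\<^sub>F k in sequentially. norm (x k - l) \<le> C * c ^ k))"

definition linearly_convergent_values :: "(nat \<Rightarrow> ereal) \<Rightarrow> ereal \<Rightarrow> bool" where
  "linearly_convergent_values s l \<longleftrightarrow>
     (\<exists>c::real. 0 < c \<and> c < 1 \<and>
        (\<forall>\<^sub>F k in sequentially. \<bar>s (Suc k) - l\<bar> \<le> ereal c * \<bar>s k - l\<bar>))"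

end

theory Submission
  imports Defs
begin

text \<open>
  Put \<open>s\<^sub>k = \<phi> (x k) - \<phi> xbar\<close>, \<open>d\<^sub>k = norm (x (k + 1) - x k)\<close> and \<open>\<psi> t = M * t powr (1 - q)\<close>.
  The descent inequality makes the gaps \<open>s\<^sub>k\<close> decrease, hence they are nonnegative and tend
  to \<open>0\<close> along with the given subsequence. If some gap is zero, descent freezes the
  sequence at \<open>xbar\<close> and every claim is trivial. Otherwise the PLK condition, tested on
  the subgradient at \<open>x k\<close>, says \<open>s\<^sub>k powr q \<le> M * (1 - q) * b * d\<^sub>k\<close> as long as \<open>x k\<close> is near
  \<open>xbar\<close> and \<open>k\<close> is large. The subgradient at \<open>x k\<close> is controlled by the step that leaves \<open>x k\<close>, the
  same step that descent controls, so this one inequality has two consequences.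

  First, \<open>\<psi>\<close> is concave, so its tangent at \<open>s\<^sub>k\<close> and the descent inequality give
  \<open>d\<^sub>k \<le> b / a * (\<psi> s\<^sub>k - \<psi> s\<^sub>k\<^sub>+\<^sub>1)\<close> (\<open>desingularized_step\<close>). The steps telescope, which both
  traps the sequence near \<open>xbar\<close> once it has come close enough and bounds the distance to
  \<open>xbar\<close> by \<open>b / a * \<psi> s\<^sub>k\<close> (\<open>dist_limit_le_potential\<close>).

  Second, squaring gives the scalar recursion
  \<open>s\<^sub>k powr (2 * q) \<le> L * (s\<^sub>k - s\<^sub>k\<^sub>+\<^sub>1)\<close> (\<open>value_recursion\<close>), and the three regimes are its
  three behaviours. For \<open>q < 1/2\<close> it forces \<open>1 \<le> L * s\<^sub>k powr (1 - 2 * q)\<close>, which is absurd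
  in the limit, so some gap is zero. For \<open>q = 1/2\<close> it is a contraction
  with factor \<open>1 - 1 / L\<close>. For \<open>q > 1/2\<close> it makes \<open>s\<^sub>k powr (1 - 2 * q)\<close> grow at least
  linearly (\<open>power_law_decay\<close>). Inserting these rates in \<open>b / a * \<psi> s\<^sub>k\<close> gives the
  rates for the points.
\<close>

section \<open>Tangent inequalities for real powers\<close>

text \<open>
  Concavity of \<open>t powr \<alpha>\<close>; Young's inequality with second factor \<open>1\<close> is this statement
  for the ratio \<open>u / t\<close>.
\<close>

lemma powr_below_tangent:
  fixes t u \<alpha> :: real
  assumes "t > 0" "u > 0" "0 \<le> \<alpha>" "\<alpha> \<le> 1"
  shows "u powr \<alpha> \<le> t powr \<alpha> + \<alpha> * t powr (\<alpha> - 1) * (u - t)"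
proof -
  have "u powr \<alpha> = t powr \<alpha> * ((u / t) powr \<alpha> * 1 powr (1 - \<alpha>))"
    using assms by (simp add: powr_divide)
  also have "\<dots> \<le> t powr \<alpha> * (\<alpha> * (u / t) + (1 - \<alpha>) * 1)"
    using assms by (intro mult_left_mono Youngs_inequality_0) auto
  also have "\<dots> = t powr \<alpha> + \<alpha> * t powr (\<alpha> - 1) * (u - t)"
    using assms by (simp add: powr_diff field_simps)
  finally show ?thesis .
qed

text \<open>
  Convexity of \<open>t powr (-p)\<close>. For the ratio \<open>z = u / t\<close>, the bounds \<open>1 + y \<le> exp y\<close> and
  \<open>ln z \<le> z - 1\<close> combine to \<open>1 - p * (z - 1) \<le> z powr (-p)\<close>.
\<close>

lemma powr_above_tangent:
  fixes t u p :: real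
  assumes "t > 0" "u > 0" "p \<ge> 0"
  shows "t powr (-p) + p * t powr (- (1 + p)) * (t - u) \<le> u powr (-p)"
proof -
  have "p * ln (u / t) \<le> p * (u / t - 1)"
    using assms by (intro mult_left_mono ln_le_minus_one) auto
  hence "1 - p * (u / t - 1) \<le> 1 + (-p) * ln (u / t)"
    by simp
  also have "\<dots> \<le> exp ((-p) * ln (u / t))"
    by (rule exp_ge_add_one_self)
  also have "\<dots> = (u / t) powr (-p)"
    using assms by (simp add: powr_def)
  finally have "t powr (-p) * (1 - p * (u / t - 1)) \<le> t powr (-p) * (u / t) powr (-p)"
    by (intro mult_left_mono) auto
  moreover have "t powr (-p) * (u / t) powr (-p) = u powr (-p)"
    using assms by (simp add: powr_divide)
  moreover have "t powr (-p) * (1 - p * (u / t - 1))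
      = t powr (-p) + p * t powr (- (1 + p)) * (t - u)"
  proof -
    have "t powr (- (1 + p)) = t powr (- p - 1)"
      by (rule arg_cong) simp
    also have "\<dots> = t powr (-p) / t"
      using assms by (simp add: powr_diff)
    finally have "t powr (- (1 + p)) = t powr (-p) / t" .
    thus ?thesis using assms by (simp add: field_simps)
  qed
  ultimately show ?thesis by simp
qed

section \<open>Convergence from a subsequence\<close>

text \<open>
  The step bound is known only near \<open>l\<close>, so staying near \<open>l\<close> and having finite length must
  be proved together. Starting from an index where both the distance to \<open>l\<close>
  and the remaining potential are below \<open>\<rho> / 2\<close>, the telescoped steps can never leave
  the ball of radius \<open>\<rho>\<close>, so the bound never stops applying.
\<close>

lemma dist_limit_le_potential:
  fixes x :: "nat \<Rightarrow> 'a::metric_space" and g :: "nat \<Rightarrow> real"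
  assumes r: "strict_mono r" "(\<lambda>j. x (r j)) \<longlonglongrightarrow> l"
    and g: "\<And>k. g k \<ge> 0" "g \<longlonglongrightarrow> 0"
    and "\<rho> > 0"
    and step: "\<forall>\<^sub>F k in sequentially. dist (x k) l < \<rho> \<longrightarrow>
                 dist (x (Suc k)) (x k) \<le> g k - g (Suc k)"
  shows "\<forall>\<^sub>F k in sequentially. dist (x k) l \<le> g k"
proof -
  obtain N where N: "\<And>k. k \<ge> N \<Longrightarrow> dist (x k) l < \<rho> \<Longrightarrow> dist (x (Suc k)) (x k) \<le> g k - g (Suc k)"
    using step by (auto simp: eventually_sequentially)
  have lim_r: "filterlim r sequentially sequentially"
    using r(1) by (rule filterlim_subseq)
  have "\<forall>\<^sub>F j in sequentially. dist (x (r j)) l < \<rho> / 2"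
    using tendstoD[OF r(2), of "\<rho> / 2"] \<open>\<rho> > 0\<close> by simp
  moreover have "\<forall>\<^sub>F j in sequentially. g (r j) < \<rho> / 2"
    using order_tendstoD(2)[OF filterlim_compose[OF g(2) lim_r], of "\<rho> / 2"] \<open>\<rho> > 0\<close> by simp
  moreover have "\<forall>\<^sub>F j in sequentially. r j \<ge> N"
    using lim_r by (simp add: filterlim_at_top)
  ultimately have "\<forall>\<^sub>F j in sequentially. dist (x (r j)) l < \<rho> / 2 \<and> g (r j) < \<rho> / 2 \<and> r j \<ge> N"
    by eventually_elim auto
  then obtain j where j: "dist (x (r j)) l < \<rho> / 2" "g (r j) < \<rho> / 2" "r j \<ge> N"
    by (auto simp: eventually_sequentially)
  define n where "n = r j"
  have near: "dist (x k) l < \<rho>" if "dist (x k) (x n) \<le> g n - g k" for k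
    using dist_triangle[of "x k" l "x n"] that g(1)[of k] j unfolding n_def by linarith
  have from_n: "dist (x k) (x n) \<le> g n - g k" if "k \<ge> n" for k
    using that
  proof (induction k rule: dec_induct)
    case (step k)
    have "dist (x (Suc k)) (x k) \<le> g k - g (Suc k)"
      using N[of k] near[OF step.IH] step.hyps j(3) unfolding n_def by linarith
    thus ?case
      using dist_triangle[of "x (Suc k)" "x n" "x k"] step.IH by linarith
  qed simp
  have between: "dist (x m) (x k) \<le> g k" if "k \<ge> n" "m \<ge> k" for k m
  proof -
    have "dist (x m) (x k) \<le> g k - g m"
      using that(2)
    proof (induction m rule: dec_induct)
      case (step m)
      have "dist (x (Suc m)) (x m) \<le> g m - g (Suc m)"
        using N[of m] near[OF from_n[of m]] step.hyps that(1) j(3) unfolding n_def by linarith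
      thus ?case
        using dist_triangle[of "x (Suc m)" "x k" "x m"] step.IH by linarith
    qed simp
    thus ?thesis using g(1)[of m] by linarith
  qed
  have "dist (x k) l \<le> g k" if "k \<ge> n" for k
  proof -
    have "(\<lambda>j. dist (x (r j)) (x k)) \<longlonglongrightarrow> dist l (x k)"
      by (intro tendsto_intros r(2))
    moreover have "\<forall>\<^sub>F j in sequentially. r j \<ge> k"
      using lim_r by (simp add: filterlim_at_top)
    hence "\<forall>\<^sub>F j in sequentially. dist (x (r j)) (x k) \<le> g k"
      by eventually_elim (use between that in auto)
    ultimately have "dist l (x k) \<le> g k"
      by (intro tendsto_upperbound) auto
    thus ?thesis by (simp add: dist_commute)
  qed
  thus ?thesis by (auto simp: eventually_sequentially)
qed

text \<open>
  Monotonicity is asked only from index \<open>m\<close> on, since the descent inequality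
  says nothing about the very first step.
\<close>

lemma antimono_tendsto_of_subseq:
  fixes s :: "nat \<Rightarrow> real"
  assumes dec: "\<And>j k. m \<le> j \<Longrightarrow> j \<le> k \<Longrightarrow> s k \<le> s j"
    and r: "strict_mono r" "(\<lambda>j. s (r j)) \<longlonglongrightarrow> l"
  shows "\<And>k. k \<ge> m \<Longrightarrow> l \<le> s k" and "s \<longlonglongrightarrow> l"
proof -
  have r_ge: "\<forall>\<^sub>F j in sequentially. r j \<ge> k" for k
    using filterlim_subseq[OF r(1)] by (simp add: filterlim_at_top)
  show ge: "l \<le> s k" if "k \<ge> m" for k
  proof (rule tendsto_upperbound[OF r(2)])
    show "\<forall>\<^sub>F j in sequentially. s (r j) \<le> s k"
      using r_ge[of k] by eventually_elim (use dec that in auto)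
  qed auto
  show "s \<longlonglongrightarrow> l"
  proof (rule order_tendstoI)
    fix y assume "y < l"
    show "\<forall>\<^sub>F k in sequentially. y < s k"
      using eventually_ge_at_top[of m] by eventually_elim (use ge \<open>y < l\<close> in fastforce)
  next
    fix y assume "l < y"
    have "\<forall>\<^sub>F j in sequentially. s (r j) < y \<and> r j \<ge> m"
      using order_tendstoD(2)[OF r(2) \<open>l < y\<close>] r_ge[of m] by eventually_elim auto
    then obtain j where j: "s (r j) < y" "r j \<ge> m"
      by (auto simp: eventually_sequentially)
    show "\<forall>\<^sub>F k in sequentially. s k < y"
      using eventually_ge_at_top[of "r j"] by eventually_elim (use dec j in fastforce)
  qed
qed

section \<open>Rates from scalar recursions\<close>

lemma geometric_decay:
  fixes s :: "nat \<Rightarrow> real"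
  assumes "c > 0" and pos: "\<forall>\<^sub>F k in sequentially. s k > 0"
    and contr: "\<forall>\<^sub>F k in sequentially. s (Suc k) \<le> c * s k"
  shows "\<exists>C>0. \<forall>\<^sub>F k in sequentially. s k \<le> C * c ^ k"
proof -
  obtain N where N: "\<And>k. k \<ge> N \<Longrightarrow> s k > 0 \<and> s (Suc k) \<le> c * s k"
    using eventually_conj[OF pos contr] by (auto simp: eventually_sequentially)
  have "s k \<le> s N / c ^ N * c ^ k" if "k \<ge> N" for k
    using that
  proof (induction k rule: dec_induct)
    case base
    thus ?case using \<open>c > 0\<close> by simp
  next
    case (step k)
    have "s (Suc k) \<le> c * s k" using N step.hyps by simp
    also have "\<dots> \<le> c * (s N / c ^ N * c ^ k)"
      using step.IH \<open>c > 0\<close> by (intro mult_left_mono) auto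
    finally show ?case by (simp add: algebra_simps)
  qed
  moreover have "s N / c ^ N > 0" using N[of N] \<open>c > 0\<close> by simp
  ultimately show ?thesis
    by (intro exI[of _ "s N / c ^ N"]) (auto simp: eventually_sequentially)
qed

text \<open>
  This is the discrete form of \<open>s' \<le> - s powr (1 + p) / L\<close>, under which \<open>s powr (-p)\<close> has
  derivative at least \<open>p / L\<close>. The tangent inequality for the convex function
  \<open>t powr (-p)\<close> turns the recursion into the same increment per step.
\<close>

lemma power_law_decay:
  fixes s :: "nat \<Rightarrow> real" and L p :: real
  assumes "p > 0" "L > 0" and pos: "\<forall>\<^sub>F k in sequentially. s k > 0"
    and rec: "\<forall>\<^sub>F k in sequentially. s k powr (1 + p) \<le> L * (s k - s (Suc k))"
  shows "\<exists>C>0. \<forall>\<^sub>F k in sequentially. s k \<le> C * real k powr (- (1 / p))"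
proof -
  obtain N where N: "\<And>k. k \<ge> N \<Longrightarrow> s k > 0 \<and> s k powr (1 + p) \<le> L * (s k - s (Suc k))"
    using eventually_conj[OF pos rec] by (auto simp: eventually_sequentially)
  have incr: "s k powr (-p) + p / L \<le> s (Suc k) powr (-p)" if "k \<ge> N" for k
  proof -
    have "s k > 0" "s (Suc k) > 0" "s k powr (1 + p) / L \<le> s k - s (Suc k)"
      using N[of k] N[of "Suc k"] that \<open>L > 0\<close> by (auto simp: field_simps)
    have "p / L = p * s k powr (- (1 + p)) * (s k powr (1 + p) / L)"
      using \<open>s k > 0\<close> by (simp add: powr_add[symmetric] flip: powr_add)
    also have "\<dots> \<le> p * s k powr (- (1 + p)) * (s k - s (Suc k))"
      using \<open>p > 0\<close> \<open>s k powr (1 + p) / L \<le> _\<close> by (intro mult_left_mono) auto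
    finally show ?thesis
      using powr_above_tangent[OF \<open>s k > 0\<close> \<open>s (Suc k) > 0\<close>, of p] \<open>p > 0\<close> by linarith
  qed
  have growth: "(real k - real N) * (p / L) \<le> s k powr (-p)" if "k \<ge> N" for k
    using that
  proof (induction k rule: dec_induct)
    case (step k)
    thus ?case using incr[of k] by (simp add: algebra_simps)
  qed simp
  \<comment> \<open>Half of the growth rate: from \<open>k = 2 * N\<close> on this absorbs the shift by \<open>N\<close>.\<close>
  define D where "D = p / (2 * L)"
  have "D > 0" using assms by (simp add: D_def)
  have "s k \<le> D powr (- (1 / p)) * real k powr (- (1 / p))" if "k \<ge> 2 * N + 1" for k
  proof -
    have "s k > 0" using N[of k] that by simp
    have "D * real k \<le> (real k - real N) * (p / L)"
    proof -
      have "(real k / 2) * (p / L) \<le> (real k - real N) * (p / L)"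
        using that assms by (intro mult_right_mono) auto
      thus ?thesis by (simp add: D_def mult.commute)
    qed
    also have "\<dots> \<le> s k powr (-p)" using growth[of k] that by simp
    finally have "(s k powr (-p)) powr (- (1 / p)) \<le> (D * real k) powr (- (1 / p))"
      using that \<open>D > 0\<close> \<open>p > 0\<close> by (intro powr_mono2') auto
    moreover have "(s k powr (-p)) powr (- (1 / p)) = s k"
      using \<open>s k > 0\<close> \<open>p > 0\<close> by (simp add: powr_powr)
    ultimately show ?thesis by (simp add: powr_mult)
  qed
  thus ?thesis
    using \<open>D > 0\<close> by (intro exI[of _ "D powr (- (1 / p))"]) (auto simp: eventually_sequentially)
qed

section \<open>Consequences of the PLK condition\<close>

text \<open>
  The condition in a form free of extended reals and of the distance to a set: every
  single subgradient is at least as long as the distance of the subdifferential from \<open>0\<close>.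
\<close>

lemma exponent_PLK_subgradient_bound:
  fixes \<phi> :: "'a::euclidean_space \<Rightarrow> ereal"
  assumes PLK: "exponent_PLK \<phi> xbar M q" and c: "\<phi> xbar = ereal c" and "M > 0" "q < 1"
  obtains \<eta> \<rho> where "\<eta> > 0" "\<rho> > 0"
    "\<And>y s w. dist y xbar < \<rho> \<Longrightarrow> \<phi> y = ereal (c + s) \<Longrightarrow> 0 < s \<Longrightarrow> s < \<eta> \<Longrightarrow>
       w \<in> limiting_subdifferential \<phi> y \<Longrightarrow> s powr q \<le> M * (1 - q) * norm w"
proof -
  obtain \<eta> U where "\<eta> > 0" and U: "open U" "xbar \<in> U"
    and ineq: "\<And>y. y \<in> U \<Longrightarrow> \<phi> xbar < \<phi> y \<Longrightarrow> \<phi> y < \<phi> xbar + ereal \<eta> \<Longrightarrow>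
      ereal (M * (1 - q) * real_of_ereal (\<phi> y - \<phi> xbar) powr (- q))
        * edist_to_set 0 (limiting_subdifferential \<phi> y) \<ge> 1"
    using PLK unfolding exponent_PLK_def by blast
  obtain \<rho> where "\<rho> > 0" and \<rho>: "\<And>y. dist y xbar < \<rho> \<Longrightarrow> y \<in> U"
    using U unfolding open_dist by blast
  show ?thesis
  proof (rule that[OF \<open>\<eta> > 0\<close> \<open>\<rho> > 0\<close>])
    fix y s w
    assume y: "dist y xbar < \<rho>" "\<phi> y = ereal (c + s)" and s: "0 < s" "s < \<eta>"
      and w: "w \<in> limiting_subdifferential \<phi> y"
    let ?A = "M * (1 - q) * s powr (- q)"
    have "1 \<le> ereal ?A * edist_to_set 0 (limiting_subdifferential \<phi> y)"
      using ineq[of y] \<rho> y s c by simp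
    also have "\<dots> \<le> ereal ?A * ereal (norm w)"
    proof (rule ereal_mult_left_mono)
      show "edist_to_set 0 (limiting_subdifferential \<phi> y) \<le> ereal (norm w)"
        unfolding edist_to_set_def using w by (intro INF_lower2[of w]) auto
    qed (use \<open>M > 0\<close> \<open>q < 1\<close> in auto)
    finally have "1 \<le> ?A * norm w" by (simp add: one_ereal_def)
    hence "s powr q * 1 \<le> s powr q * (?A * norm w)"
      by (intro mult_left_mono) auto
    also have "\<dots> = M * (1 - q) * norm w"
      using s by (simp add: powr_minus field_simps)
    finally show "s powr q \<le> M * (1 - q) * norm w" by simp
  qed
qed


text \<open>
  Here \<open>t\<close> and \<open>u\<close> are consecutive value gaps and \<open>d\<close> is the length of the step between them.
  The PLK bound reads \<open>1 \<le> \<psi>' t * b * d\<close>; multiplied by \<open>d\<close>, it leaves \<open>\<psi>' t * d\<^sup>2\<close>, which descent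
  and concavity of \<open>\<psi>\<close> bound by \<open>(\<psi> t - \<psi> u) / a\<close>.
\<close>

lemma desingularized_step:
  fixes t u d a b M q :: real
  assumes "t > 0" "u > 0" "a > 0" "b > 0" "M > 0" "0 \<le> q" "q < 1" "d \<ge> 0"
    and descent: "u + a * d\<^sup>2 \<le> t" and bound: "t powr q \<le> M * (1 - q) * (b * d)"
  shows "d \<le> b / a * M * t powr (1 - q) - b / a * M * u powr (1 - q)"
proof -
  have "1 = t powr (- q) * t powr q"
    using assms by (simp flip: powr_add)
  also have "\<dots> \<le> t powr (- q) * (M * (1 - q) * (b * d))"
    using bound by (intro mult_left_mono) auto
  finally have "1 * d \<le> t powr (- q) * (M * (1 - q) * (b * d)) * d"
    using \<open>d \<ge> 0\<close> by (intro mult_right_mono)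
  also have "\<dots> = b / a * M * ((1 - q) * t powr (- q) * (a * d\<^sup>2))"
    using \<open>a > 0\<close> by (simp add: power2_eq_square)
  also have "\<dots> \<le> b / a * M * ((1 - q) * t powr (- q) * (t - u))"
    using assms by (intro mult_left_mono) auto
  also have "\<dots> \<le> b / a * M * (t powr (1 - q) - u powr (1 - q))"
    using assms powr_below_tangent[of t u "1 - q"]
    by (intro mult_left_mono) (auto simp: algebra_simps)
  finally show ?thesis by (simp add: algebra_simps)
qed

text \<open>
  Eliminating the step length between the PLK bound and the descent inequality leaves a
  recursion for the values alone.
\<close>

lemma value_recursion:
  fixes t u d a K q :: real
  assumes "t > 0" "a > 0"
    and descent: "u + a * d\<^sup>2 \<le> t" and bound: "t powr q \<le> K * d"
  shows "t powr (2 * q) \<le> K\<^sup>2 / a * (t - u)"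
proof -
  have "t powr (2 * q) = (t powr q)\<^sup>2"
    using \<open>t > 0\<close> by (simp add: power2_eq_square flip: powr_add)
  also have "\<dots> \<le> (K * d)\<^sup>2"
    using bound by (intro power_mono) auto
  also have "\<dots> = K\<^sup>2 / a * (a * d\<^sup>2)"
    using \<open>a > 0\<close> by (simp add: power_mult_distrib)
  also have "\<dots> \<le> K\<^sup>2 / a * (t - u)"
    using descent \<open>a > 0\<close> by (intro mult_left_mono) auto
  finally show ?thesis .
qed

section \<open>Convergence rates\<close>

theorem theorem4:
  fixes \<phi> :: "real ^ 'n \<Rightarrow> ereal"
    and x :: "nat \<Rightarrow> real ^ 'n"
    and xbar :: "real ^ 'n"
    and a b M q :: real
  assumes "proper_fun \<phi>"
    and "lower_semicontinuous \<phi>"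
    and "bounded_from_below \<phi>"
    and "a > 0" and "b > 0"
    and "\<And>k. k \<ge> 1 \<Longrightarrow> \<phi> (x (k + 1)) + ereal (a * (norm (x (k + 1) - x k))\<^sup>2) \<le> \<phi> (x k)"
    and "\<And>k. k \<ge> 1 \<Longrightarrow>
           \<exists>w \<in> limiting_subdifferential \<phi> (x k). norm w \<le> b * norm (x (k + 1) - x k)"
    and "xbar \<in> edom \<phi>"
    and "\<exists>r. strict_mono r \<and> (\<lambda>j. x (r j)) \<longlonglongrightarrow> xbar \<and> (\<lambda>j. \<phi> (x (r j))) \<longlonglongrightarrow> \<phi> xbar"
    and "M > 0" and "0 \<le> q" and "q < 1"
    and "exponent_PLK \<phi> xbar M q"
  shows "(q < 1/2 \<longrightarrow>
            terminates_at x xbar \<and> terminates_at (\<lambda>k. \<phi> (x k)) (\<phi> xbar)) \<and>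
         (q = 1/2 \<longrightarrow>
            linearly_convergent_points x xbar \<and>
            linearly_convergent_values (\<lambda>k. \<phi> (x k)) (\<phi> xbar)) \<and>
         (1/2 < q \<longrightarrow>
            (\<exists>\<sigma>>0. \<forall>\<^sub>F k in sequentially.
               norm (x k - xbar) \<le> \<sigma> * real k powr (- ((1 - q) / (2 * q - 1)))))"
proof -
  obtain r where r: "strict_mono r" "(\<lambda>j. x (r j)) \<longlonglongrightarrow> xbar"
      "(\<lambda>j. \<phi> (x (r j))) \<longlonglongrightarrow> \<phi> xbar"
    using assms(9) by blast
  have finite_on_edom: "\<exists>t. \<phi> y = ereal t" if "y \<in> edom \<phi>" for y
    using that \<open>proper_fun \<phi>\<close> by (cases "\<phi> y") (auto simp: edom_def proper_fun_def)
  obtain c where c: "\<phi> xbar = ereal c"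
    using finite_on_edom[OF \<open>xbar \<in> edom \<phi>\<close>] by blast
  define s where "s k = real_of_ereal (\<phi> (x k)) - c" for k
  define d where "d k = norm (x (Suc k) - x k)" for k
  have \<phi>_x: "\<phi> (x k) = ereal (c + s k)" if "k \<ge> 1" for k
  proof -
    have "x k \<in> edom \<phi>"
      using assms(7)[OF that] by (auto simp: limiting_subdifferential_def)
    thus ?thesis using finite_on_edom[of "x k"] by (auto simp: s_def)
  qed
  have descent: "s (Suc k) + a * (d k)\<^sup>2 \<le> s k" if "k \<ge> 1" for k
    using assms(6)[OF that] \<phi>_x[OF that] \<phi>_x[of "Suc k"] by (simp add: d_def)
  have s_le: "s k \<le> s j" if "1 \<le> j" "j \<le> k" for j k
    using that(2)
  proof (induction k rule: dec_induct)
    case (step k)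
    have "0 \<le> a * (d k)\<^sup>2" using \<open>a > 0\<close> by simp
    thus ?case using step descent[of k] that(1) by linarith
  qed simp
  have "(\<lambda>j. real_of_ereal (\<phi> (x (r j)))) \<longlonglongrightarrow> c"
    using lim_real_of_ereal[OF r(3)[unfolded c]] .
  hence "(\<lambda>j. s (r j)) \<longlonglongrightarrow> 0"
    unfolding s_def by (rule tendsto_diff[OF _ tendsto_const, of _ c _ c, simplified])
  from antimono_tendsto_of_subseq[of 1 s, OF s_le r(1) this]
  have s_ge: "\<And>k. k \<ge> 1 \<Longrightarrow> 0 \<le> s k" and s_lim: "s \<longlonglongrightarrow> 0"
    by auto
  have lim_r: "filterlim r sequentially sequentially"
    using r(1) by (rule filterlim_subseq)

  show ?thesis
  proof (cases "\<exists>n\<ge>1. s n = 0")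
    case True
    then obtain n where n: "n \<ge> 1" "s n = 0" by blast
    have s0: "s k = 0" if "k \<ge> n" for k
      using s_le[OF n(1) that] s_ge[of k] n that by simp
    have frozen: "x (Suc k) = x k" if "k \<ge> n" for k
    proof -
      have "a * (d k)\<^sup>2 \<le> 0" using descent[of k] s0[of k] s0[of "Suc k"] n that by simp
      thus ?thesis using \<open>a > 0\<close> by (simp add: mult_le_0_iff d_def)
    qed
    have const: "x k = x n" if "k \<ge> n" for k
      using that by (induction k rule: dec_induct) (auto simp: frozen)
    have "\<forall>\<^sub>F j in sequentially. x (r j) = x n"
      using lim_r[unfolded filterlim_at_top, rule_format, of n]
      by eventually_elim (rule const)
    hence "(\<lambda>j. x (r j)) \<longlonglongrightarrow> x n" by (rule tendsto_eventually)
    hence "x n = xbar" using r(2) LIMSEQ_unique by blast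
    hence x_term: "\<forall>\<^sub>F k in sequentially. x k = xbar"
      unfolding eventually_sequentially using const by metis
    have "terminates_at x xbar" "terminates_at (\<lambda>k. \<phi> (x k)) (\<phi> xbar)"
      unfolding terminates_at_def using x_term by (auto elim: eventually_mono)
    moreover have "linearly_convergent_points x xbar"
      unfolding linearly_convergent_points_def
      by (rule exI[of _ 1], rule exI[of _ "1/2"]) (use x_term in \<open>auto elim: eventually_mono\<close>)
    moreover have "linearly_convergent_values (\<lambda>k. \<phi> (x k)) (\<phi> xbar)"
      unfolding linearly_convergent_values_def
    proof (intro exI[of _ "1/2"] conjI)
      have "\<forall>\<^sub>F k in sequentially. x (Suc k) = xbar"
        using x_term eventually_sequentially_Suc[of "\<lambda>k. x k = xbar"] by simp
      thus "\<forall>\<^sub>F k in sequentially.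
          \<bar>\<phi> (x (Suc k)) - \<phi> xbar\<bar> \<le> ereal (1/2) * \<bar>\<phi> (x k) - \<phi> xbar\<bar>"
        using x_term by eventually_elim (simp add: c)
    qed auto
    moreover have "\<exists>\<sigma>>0. \<forall>\<^sub>F k in sequentially.
        norm (x k - xbar) \<le> \<sigma> * real k powr (- ((1 - q) / (2 * q - 1)))"
      by (intro exI[of _ 1]) (use x_term in \<open>auto elim: eventually_mono\<close>)
    ultimately show ?thesis by blast
  next
    case False
    hence s_pos: "s k > 0" if "k \<ge> 1" for k
      using s_ge[of k] that by force
    hence ev_pos: "\<forall>\<^sub>F k in sequentially. s k > 0"
      by (auto simp: eventually_sequentially)
    obtain \<eta> \<rho> where "\<eta> > 0" "\<rho> > 0" and
      sub: "\<And>y t w. dist y xbar < \<rho> \<Longrightarrow> \<phi> y = ereal (c + t) \<Longrightarrow> 0 < t \<Longrightarrow> t < \<eta> \<Longrightarrow>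
        w \<in> limiting_subdifferential \<phi> y \<Longrightarrow> t powr q \<le> M * (1 - q) * norm w"
      using exponent_PLK_subgradient_bound[OF \<open>exponent_PLK \<phi> xbar M q\<close> c \<open>M > 0\<close> \<open>q < 1\<close>]
      by metis
    have PLK_step: "s k powr q \<le> M * (1 - q) * (b * d k)"
      if k: "k \<ge> 1" "s k < \<eta>" "dist (x k) xbar < \<rho>" for k
    proof -
      obtain w where w: "w \<in> limiting_subdifferential \<phi> (x k)" "norm w \<le> b * d k"
        using assms(7)[OF k(1)] by (auto simp: d_def)
      have "s k powr q \<le> M * (1 - q) * norm w"
        using sub[OF k(3) \<phi>_x[OF k(1)] s_pos[OF k(1)] k(2) w(1)] .
      also have "\<dots> \<le> M * (1 - q) * (b * d k)"
        using w(2) \<open>M > 0\<close> \<open>q < 1\<close> by (intro mult_left_mono) auto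
      finally show ?thesis .
    qed
    have near: "\<forall>\<^sub>F k in sequentially. k \<ge> 1 \<and>
        (dist (x k) xbar < \<rho> \<longrightarrow> s k powr q \<le> M * (1 - q) * (b * d k))"
      using eventually_ge_at_top[of 1] order_tendstoD(2)[OF s_lim \<open>\<eta> > 0\<close>]
      by eventually_elim (use PLK_step in blast)

    \<comment> \<open>Closeness of \<open>x k\<close> to \<open>xbar\<close> stays a premise here and in \<open>rec\<close>; it is known
      to hold from some index on only after the trapping argument.\<close>
    define L where "L = (M * (1 - q) * b)\<^sup>2 / a"
    have "L > 0"
      using \<open>M > 0\<close> \<open>q < 1\<close> \<open>b > 0\<close> \<open>a > 0\<close> by (simp add: L_def)
    have rec: "\<forall>\<^sub>F k in sequentially. dist (x k) xbar < \<rho> \<longrightarrow>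
        s k powr (2 * q) \<le> L * (s k - s (Suc k))"
      using near
    proof eventually_elim
      case (elim k)
      thus ?case
        using value_recursion[of "s k" a "s (Suc k)" "d k" q "M * (1 - q) * b"]
          s_pos[of k] descent[of k] \<open>a > 0\<close>
        unfolding L_def by (simp add: mult.assoc)
    qed

    define g where "g k = b / a * M * s k powr (1 - q)" for k
    have g_step: "\<forall>\<^sub>F k in sequentially. dist (x k) xbar < \<rho> \<longrightarrow>
        dist (x (Suc k)) (x k) \<le> g k - g (Suc k)"
      using near
    proof eventually_elim
      case (elim k)
      show ?case
      proof
        assume "dist (x k) xbar < \<rho>"
        hence bound: "s k powr q \<le> M * (1 - q) * (b * d k)" and "k \<ge> 1"
          using elim by auto
        have "s k > 0" "s (Suc k) > 0" "d k \<ge> 0"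
          using s_pos \<open>k \<ge> 1\<close> by (auto simp: d_def)
        hence "d k \<le> b / a * M * s k powr (1 - q) - b / a * M * s (Suc k) powr (1 - q)"
          using desingularized_step[of "s k" "s (Suc k)" a b M q "d k",
              OF _ _ \<open>a > 0\<close> \<open>b > 0\<close> \<open>M > 0\<close> \<open>0 \<le> q\<close> \<open>q < 1\<close> _ descent[OF \<open>k \<ge> 1\<close>] bound]
          by blast
        thus "dist (x (Suc k)) (x k) \<le> g k - g (Suc k)"
          by (simp add: g_def d_def dist_norm)
      qed
    qed
    have powr_lim: "(\<lambda>k. s k powr e) \<longlonglongrightarrow> 0" if "e > 0" for e
      using ev_pos that
      by (intro tendsto_zero_powrI[OF s_lim tendsto_const]) (auto elim: eventually_mono)
    have g_lim: "g \<longlonglongrightarrow> 0"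
      unfolding g_def using \<open>q < 1\<close> by (intro tendsto_mult_right_zero powr_lim) simp
    have g_nonneg: "g k \<ge> 0" for k
      unfolding g_def using \<open>a > 0\<close> \<open>b > 0\<close> \<open>M > 0\<close> by simp
    have dist_le: "\<forall>\<^sub>F k in sequentially. dist (x k) xbar \<le> g k"
      using dist_limit_le_potential[OF r(1,2) g_nonneg g_lim \<open>\<rho> > 0\<close> g_step] .
    have "\<forall>\<^sub>F k in sequentially. dist (x k) xbar < \<rho>"
      using dist_le order_tendstoD(2)[OF g_lim \<open>\<rho> > 0\<close>] by eventually_elim linarith
    with rec have s_rec: "\<forall>\<^sub>F k in sequentially. s k powr (2 * q) \<le> L * (s k - s (Suc k))"
      by eventually_elim blast

    have "False" if "q < 1/2"
    proof -
      have "(\<lambda>k. L * s k powr (1 - 2 * q)) \<longlonglongrightarrow> 0"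
        using that by (intro tendsto_mult_right_zero powr_lim) simp
      hence "\<forall>\<^sub>F k in sequentially. L * s k powr (1 - 2 * q) < 1"
        by (rule order_tendstoD) simp
      with s_rec eventually_ge_at_top[of 1] have "\<forall>\<^sub>F k::nat in sequentially. False"
      proof eventually_elim
        case (elim k)
        have "s k > 0" "s (Suc k) > 0" using s_pos elim by auto
        have "s k powr (2 * q) \<le> L * (s k - s (Suc k))" using elim by simp
        also have "\<dots> \<le> L * s k"
          using \<open>L > 0\<close> \<open>s (Suc k) > 0\<close> by simp
        also have "\<dots> = (L * s k powr (1 - 2 * q)) * s k powr (2 * q)"
          using \<open>s k > 0\<close> by (simp flip: powr_add)
        also have "\<dots> < 1 * s k powr (2 * q)"
          using elim \<open>s k > 0\<close> by (intro mult_strict_right_mono) auto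
        finally show False by simp
      qed
      thus False by simp
    qed

    moreover have "linearly_convergent_points x xbar \<and>
        linearly_convergent_values (\<lambda>k. \<phi> (x k)) (\<phi> xbar)" if "q = 1/2"
    proof -
      define \<theta> where "\<theta> = 1 - 1 / L"
      have "\<theta> < 1" using \<open>L > 0\<close> by (simp add: \<theta>_def)
      have contr: "\<forall>\<^sub>F k in sequentially. k \<ge> 1 \<and> s (Suc k) \<le> \<theta> * s k"
        using s_rec eventually_ge_at_top[of 1]
      proof eventually_elim
        case (elim k)
        hence "s k \<le> L * (s k - s (Suc k))" using s_pos[of k] that by simp
        thus ?case using \<open>L > 0\<close> elim by (simp add: \<theta>_def field_simps)
      qed
      \<comment> \<open>The contraction factor cannot vanish, because all the gaps are positive.\<close>
      have "\<theta> > 0"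
      proof -
        obtain k where k: "k \<ge> 1" "s (Suc k) \<le> \<theta> * s k"
          using contr by (auto simp: eventually_sequentially)
        hence "0 < \<theta> * s k" using s_pos[of "Suc k"] by linarith
        thus ?thesis using s_pos[OF k(1)] by (simp add: zero_less_mult_iff)
      qed
      obtain C where "C > 0" and C: "\<forall>\<^sub>F k in sequentially. s k \<le> C * \<theta> ^ k"
        using geometric_decay[OF \<open>\<theta> > 0\<close> ev_pos] contr unfolding eventually_conj_iff by blast
      have "linearly_convergent_points x xbar"
        unfolding linearly_convergent_points_def
      proof (rule exI[of _ "b / a * M * sqrt C"], rule exI[of _ "sqrt \<theta>"], intro conjI)
        show "\<forall>\<^sub>F k in sequentially. norm (x k - xbar) \<le> b / a * M * sqrt C * sqrt \<theta> ^ k"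
          using dist_le C ev_pos
        proof eventually_elim
          case (elim k)
          have "norm (x k - xbar) \<le> b / a * M * sqrt (s k)"
            using elim that by (simp add: g_def dist_norm powr_half_sqrt)
          also have "\<dots> \<le> b / a * M * sqrt (C * \<theta> ^ k)"
            using elim \<open>a > 0\<close> \<open>b > 0\<close> \<open>M > 0\<close> by (intro mult_left_mono) auto
          finally show ?case by (simp add: real_sqrt_mult real_sqrt_power)
        qed
      qed (use \<open>\<theta> > 0\<close> \<open>\<theta> < 1\<close> \<open>C > 0\<close> \<open>a > 0\<close> \<open>b > 0\<close> \<open>M > 0\<close> in auto)
      moreover have "linearly_convergent_values (\<lambda>k. \<phi> (x k)) (\<phi> xbar)"
        unfolding linearly_convergent_values_def
      proof (intro exI[of _ \<theta>] conjI)
        show "\<forall>\<^sub>F k in sequentially.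
            \<bar>\<phi> (x (Suc k)) - \<phi> xbar\<bar> \<le> ereal \<theta> * \<bar>\<phi> (x k) - \<phi> xbar\<bar>"
          using contr
        proof eventually_elim
          case (elim k)
          thus ?case
            using s_pos[of k] s_pos[of "Suc k"] \<phi>_x[of k] \<phi>_x[of "Suc k"] by (simp add: c)
        qed
      qed (use \<open>\<theta> > 0\<close> \<open>\<theta> < 1\<close> in auto)
      ultimately show ?thesis by blast
    qed

    moreover have "\<exists>\<sigma>>0. \<forall>\<^sub>F k in sequentially.
        norm (x k - xbar) \<le> \<sigma> * real k powr (- ((1 - q) / (2 * q - 1)))" if q: "1/2 < q"
    proof -
      obtain C where "C > 0" and
        C: "\<forall>\<^sub>F k in sequentially. s k \<le> C * real k powr (- (1 / (2 * q - 1)))"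
        using power_law_decay[of "2 * q - 1" L s] q \<open>L > 0\<close> ev_pos s_rec by auto
      have "\<forall>\<^sub>F k in sequentially. norm (x k - xbar)
          \<le> b / a * M * C powr (1 - q) * real k powr (- ((1 - q) / (2 * q - 1)))"
        using dist_le C ev_pos
      proof eventually_elim
        case (elim k)
        have "norm (x k - xbar) \<le> b / a * M * s k powr (1 - q)"
          using elim by (simp add: g_def dist_norm)
        also have "\<dots> \<le> b / a * M * (C * real k powr (- (1 / (2 * q - 1)))) powr (1 - q)"
          using elim \<open>a > 0\<close> \<open>b > 0\<close> \<open>M > 0\<close> \<open>q < 1\<close>
          by (intro mult_left_mono powr_mono2) auto
        also have "\<dots> = b / a * M * C powr (1 - q) * real k powr (- ((1 - q) / (2 * q - 1)))"
          by (simp add: powr_mult powr_powr)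
        finally show ?case .
      qed
      moreover have "b / a * M * C powr (1 - q) > 0"
        using \<open>C > 0\<close> \<open>a > 0\<close> \<open>b > 0\<close> \<open>M > 0\<close> by simp
      ultimately show ?thesis by blast
    qed

    ultimately show ?thesis by blast
  qed
qed

end
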